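(* Let $H$ be a Hilbert space, $C\subseteq H$ a closed convex set, $N\ge 1$, and for each $i\in\{1,\dots,N\}$ let $k_i\in[0,1)$ and let $T_i:C\to C$ be a $k_i$-strict pseudocontraction. Put $k:=\max_{1\le i\le N}k_i$. Let $x\in C$, let $(t_n)_{n\in\mathbb{N}}\subseteq[k,1]$, and let $(\lambda_i^{(n)})_{n\in\mathbb{N}}$, $1\le i\le N$, be sequences of positive reals with $\sum_{i=1}^N\lambda_i^{(n)}=1$ for every $n\in\mathbb{N}$. Let $(x_n)_{n\in\mathbb{N}}$ be the output of the parallel algorithm associated with $(T_i)_{1\le i\le N}$, $x$, $(t_n)$, $(\lambda_i^{(n)})$. Suppose that: (1) $b>0$ and $p\in\bigcap_{i=1}^N Fix(T_i)$ satisfy $\|x\|\le b$ and $\|x-p\|\le b$; (2) $a>0$ and $a\le\inf_{i,n}\lambda_i^{(n)}$; (3) $\theta:\mathbb{N}\to\mathbb{N}$ satisfies $\sum_{n=0}^{\theta(K)}(t_n-k)(1-t_n)\ge K$ for all $K\in\mathbb{N}$; (4) $\gamma:(0,\infty)\to\mathbb{N}$ satisfies $\sum_{j=\gamma(\varepsilon)+1}^{\gamma(\varepsilon)+m}\sum_{i=1}^N|\lambda_i^{(j+1)}-\lambda_i^{(j)}|\le\varepsilon$ for all $\varepsilon>0$ and $m\in\mathbb{N}$. Set, for all $\varepsilon>0$, $$\Phi''_{a,b,k,\theta,\gamma}(\varepsilon):=\Phi'_{a,b,\theta,\gamma}((1-k)\varepsilon).$$ Then for all $\varepsilon>0$, all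 $n\ge\Phi''_{a,b,k,\theta,\gamma}(\varepsilon)$ and all $i\in\{1,\dots,N\}$, $\|x_n-T_ix_n\|\le\varepsilon$.
   Context: For $k\in[0,1)$, a mapping $T:C\to H$ is a $k$-strict pseudocontraction if for all $x,y\in C$: $\|Tx-Ty\|^2\le\|x-y\|^2+k\|(x-Tx)-(y-Ty)\|^2$. $Fix(T)$ denotes the set of fixed points of $T$. Parallel algorithm: with $A_n:=\sum_{i=1}^N\lambda_i^{(n)}T_i$ for $n\ge0$, the output sequence is $x_0:=x$, $x_{n+1}:=t_nx_n+(1-t_n)A_nx_n$. For $\varepsilon>0$ define $$\Phi_{b,\theta,\gamma}(\varepsilon):=\theta\left(\gamma\left(\frac{\varepsilon}{6b}\right)+\left\lceil\frac{4b^2}{\varepsilon^2}\right\rceil+1\right),$$ $$P_{a,b}(\varepsilon):=\min\left\{\frac{\varepsilon}{2},\ \sqrt{\frac{a\varepsilon^2}{4(1-a)}+b^2}-b\right\},$$ $$\Phi'_{a,b,\theta,\gamma}(\varepsilon):=\Phi_{b,\theta,\gamma}(P_{a,b}(\varepsilon)).$$ *)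

theory Defs
  imports "HOL-Analysis.Analysis"
begin

text \<open>Maps \<open>C \<rightarrow> H\<close> are represented by total functions on the ambient space; only their values on
  \<open>C\<close> matter.\<close>

definition strict_pseudocontraction_on ::
  "real \<Rightarrow> 'a::real_inner set \<Rightarrow> ('a \<Rightarrow> 'a) \<Rightarrow> bool" where
  "strict_pseudocontraction_on k C T \<longleftrightarrow>
     (\<forall>x\<in>C. \<forall>y\<in>C. (norm (T x - T y))\<^sup>2 \<le> (norm (x - y))\<^sup>2 + k * (norm ((x - T x) - (y - T y)))\<^sup>2)"

definition Fix_on :: "'a set \<Rightarrow> ('a \<Rightarrow> 'a) \<Rightarrow> 'a set" where
  "Fix_on C T = {p \<in> C. T p = p}"

text \<open>Weights are indexed as \<open>lam n i\<close>, standing for $\lambda_i^{(n)}$ with $1 \le i \le N$.\<close>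

definition parallel_operator ::
  "nat \<Rightarrow> (nat \<Rightarrow> 'a \<Rightarrow> 'a) \<Rightarrow> (nat \<Rightarrow> nat \<Rightarrow> real) \<Rightarrow> nat \<Rightarrow> 'a::real_vector \<Rightarrow> 'a" where
  "parallel_operator N T lam n y = (\<Sum>i=1..N. lam n i *\<^sub>R T i y)"

primrec parallel_output ::
  "nat \<Rightarrow> (nat \<Rightarrow> 'a \<Rightarrow> 'a) \<Rightarrow> 'a::real_vector \<Rightarrow> (nat \<Rightarrow> real) \<Rightarrow> (nat \<Rightarrow> nat \<Rightarrow> real) \<Rightarrow> nat \<Rightarrow> 'a" where
  "parallel_output N T x t lam 0 = x"
| "parallel_output N T x t lam (Suc n) =
     t n *\<^sub>R parallel_output N T x t lam n
       + (1 - t n) *\<^sub>R parallel_operator N T lam n (parallel_output N T x t lam n)"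

definition Phi :: "real \<Rightarrow> (nat \<Rightarrow> nat) \<Rightarrow> (real \<Rightarrow> nat) \<Rightarrow> real \<Rightarrow> nat" where
  "Phi b \<theta> \<gamma> \<epsilon> = \<theta> (\<gamma> (\<epsilon> / (6 * b)) + nat \<lceil>4 * b\<^sup>2 / \<epsilon>\<^sup>2\<rceil> + 1)"

text \<open>For \<open>a = 1\<close> (possible only when there is a single operator) the second entry of the minimum
  has denominator \<open>0\<close>; it is read as \<open>+\<infinity>\<close>, its limit as \<open>a\<close> tends to \<open>1\<close> from below, rather than as
  the value given by \<open>x / 0 = 0\<close>.\<close>

definition P_mod :: "real \<Rightarrow> real \<Rightarrow> real \<Rightarrow> real" where
  "P_mod a b \<epsilon> =
     (if a = 1 then \<epsilon> / 2
      else min (\<epsilon> / 2) (sqrt (a * \<epsilon>\<^sup>2 / (4 * (1 - a)) + b\<^sup>2) - b))"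

definition Phi' :: "real \<Rightarrow> real \<Rightarrow> (nat \<Rightarrow> nat) \<Rightarrow> (real \<Rightarrow> nat) \<Rightarrow> real \<Rightarrow> nat" where
  "Phi' a b \<theta> \<gamma> \<epsilon> = Phi b \<theta> \<gamma> (P_mod a b \<epsilon>)"

definition Phi'' :: "real \<Rightarrow> real \<Rightarrow> real \<Rightarrow> (nat \<Rightarrow> nat) \<Rightarrow> (real \<Rightarrow> nat) \<Rightarrow> real \<Rightarrow> nat" where
  "Phi'' a b k \<theta> \<gamma> \<epsilon> = Phi' a b \<theta> \<gamma> ((1 - k) * \<epsilon>)"

end

theory Submission
  imports Defs
begin

text \<open>For a \<open>k\<close>-strict pseudocontraction \<open>T\<close> the relaxation \<open>k I + (1 - k) T\<close> is nonexpansive, and the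
  parallel algorithm for the \<open>T\<^sub>i\<close> with parameters \<open>t\<^sub>n\<close> is the parallel algorithm for these relaxations
  with parameters \<open>(t\<^sub>n - k) / (1 - k)\<close>; this accounts for the factor \<open>1 - k\<close> in the rate. In the
  nonexpansive case, put \<open>u\<^sub>n = \<parallel>x\<^sub>n - A\<^sub>n x\<^sub>n\<parallel>\<close>. Then \<open>\<Sum> t\<^sub>n (1 - t\<^sub>n) u\<^sub>n\<^sup>2 \<le> b\<^sup>2\<close>, so that some \<open>u\<^sub>j\<close> is
  small for a controlled \<open>j\<close> beyond the Cauchy modulus of the weights; and \<open>u\<close> increases from then on
  by at most \<open>b\<close> times the total variation of the weights. Finally, the inequality
  \<open>\<parallel>y - S y\<parallel>\<^sup>2 \<le> 2 \<langle>y - S y, y - p\<rangle>\<close>, averaged over the operators, bounds each single displacement by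
  that of \<open>A\<^sub>n\<close>.\<close>

section \<open>Strict pseudocontractions and their relaxations\<close>

lemma norm_convex_combination_square:
  fixes u v :: "'a::real_inner"
  shows "(norm (s *\<^sub>R u + (1 - s) *\<^sub>R v))\<^sup>2
    = s * (norm u)\<^sup>2 + (1 - s) * (norm v)\<^sup>2 - s * (1 - s) * (norm (u - v))\<^sup>2"
  unfolding power2_norm_eq_inner
  by (simp add: inner_simps inner_commute algebra_simps)

lemma strict_pseudocontraction_on_mono:
  assumes "strict_pseudocontraction_on k C T" and "k \<le> k'"
  shows "strict_pseudocontraction_on k' C T"
  unfolding strict_pseudocontraction_on_def
proof (intro ballI)
  fix y z assume "y \<in> C" "z \<in> C"
  then have "(norm (T y - T z))\<^sup>2 \<le> (norm (y - z))\<^sup>2 + k * (norm ((y - T y) - (z - T z)))\<^sup>2"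
    using assms(1) unfolding strict_pseudocontraction_on_def by blast
  also have "\<dots> \<le> (norm (y - z))\<^sup>2 + k' * (norm ((y - T y) - (z - T z)))\<^sup>2"
    using assms(2) by (intro add_left_mono mult_right_mono) auto
  finally show "(norm (T y - T z))\<^sup>2 \<le> (norm (y - z))\<^sup>2 + k' * (norm ((y - T y) - (z - T z)))\<^sup>2" .
qed

text \<open>In the identity for squared norms of convex combinations, the negative term
  \<open>k * (1 - k) * (norm (u - v))\<^sup>2\<close> cancels exactly the excess allowed to
  \<open>T\<close>, weighted by \<open>1 - k\<close>.\<close>

lemma strict_pseudocontraction_relaxation_nonexpansive:
  fixes T :: "'a::real_inner \<Rightarrow> 'a"
  assumes "strict_pseudocontraction_on k C T" and "k \<le> 1" and "y \<in> C" and "z \<in> C"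
  shows "norm ((k *\<^sub>R y + (1 - k) *\<^sub>R T y) - (k *\<^sub>R z + (1 - k) *\<^sub>R T z)) \<le> norm (y - z)"
proof (rule power2_le_imp_le)
  define u where "u = y - z"
  define v where "v = T y - T z"
  have uv: "(y - T y) - (z - T z) = u - v"
    by (simp add: u_def v_def)
  have v: "(norm v)\<^sup>2 \<le> (norm u)\<^sup>2 + k * (norm (u - v))\<^sup>2"
    using assms unfolding strict_pseudocontraction_on_def u_def v_def uv[unfolded u_def v_def, symmetric]
    by blast
  have "(k *\<^sub>R y + (1 - k) *\<^sub>R T y) - (k *\<^sub>R z + (1 - k) *\<^sub>R T z) = k *\<^sub>R u + (1 - k) *\<^sub>R v"
    by (simp add: u_def v_def algebra_simps)
  then have "(norm ((k *\<^sub>R y + (1 - k) *\<^sub>R T y) - (k *\<^sub>R z + (1 - k) *\<^sub>R T z)))\<^sup>2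
      = k * (norm u)\<^sup>2 + (1 - k) * (norm v)\<^sup>2 - k * (1 - k) * (norm (u - v))\<^sup>2"
    by (simp add: norm_convex_combination_square)
  also have "\<dots> \<le> k * (norm u)\<^sup>2 + (1 - k) * ((norm u)\<^sup>2 + k * (norm (u - v))\<^sup>2)
      - k * (1 - k) * (norm (u - v))\<^sup>2"
    using v assms(2) by (intro diff_right_mono add_left_mono mult_left_mono) auto
  also have "\<dots> = (norm u)\<^sup>2"
    by (simp add: algebra_simps)
  finally show "(norm ((k *\<^sub>R y + (1 - k) *\<^sub>R T y) - (k *\<^sub>R z + (1 - k) *\<^sub>R T z)))\<^sup>2 \<le> (norm (y - z))\<^sup>2"
    by (simp add: u_def)
qed simp

text \<open>Relaxation commutes with averaging because the weights sum to 1. The new parameter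
  \<open>s\<close> is the solution of \<open>s + (1 - s) * k = t n\<close>, so both recursions take
  the same step.\<close>

lemma parallel_output_relaxation:
  assumes "k \<noteq> 1" and "\<And>n. (\<Sum>i=1..N. lam n i) = 1"
  shows "parallel_output N (\<lambda>i y. k *\<^sub>R y + (1 - k) *\<^sub>R T i y) x (\<lambda>n. (t n - k) / (1 - k)) lam n
    = parallel_output N T x t lam n"
proof (induction n)
  case (Suc n)
  let ?y = "parallel_output N T x t lam n"
  let ?s = "(t n - k) / (1 - k)"
  have "parallel_operator N (\<lambda>i y. k *\<^sub>R y + (1 - k) *\<^sub>R T i y) lam n ?y
      = (\<Sum>i=1..N. lam n i *\<^sub>R (k *\<^sub>R ?y)) + (\<Sum>i=1..N. lam n i *\<^sub>R (1 - k) *\<^sub>R T i ?y)"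
    by (simp add: parallel_operator_def scaleR_add_right sum.distrib)
  also have "(\<Sum>i=1..N. lam n i *\<^sub>R (k *\<^sub>R ?y)) = k *\<^sub>R ?y"
    by (simp only: scaleR_left.sum[symmetric] assms(2) scaleR_one)
  also have "(\<Sum>i=1..N. lam n i *\<^sub>R (1 - k) *\<^sub>R T i ?y) = (1 - k) *\<^sub>R parallel_operator N T lam n ?y"
    by (simp add: parallel_operator_def scaleR_sum_right mult.commute)
  finally have A: "parallel_operator N (\<lambda>i y. k *\<^sub>R y + (1 - k) *\<^sub>R T i y) lam n ?y
      = k *\<^sub>R ?y + (1 - k) *\<^sub>R parallel_operator N T lam n ?y" .
  have 1: "(1 - ?s) * (1 - k) = 1 - t n"
    using assms(1) by (simp add: field_simps)
  have 2: "?s + (1 - ?s) * k = t n"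
    using assms(1) by (simp add: divide_simps) (simp add: algebra_simps)
  have "?s *\<^sub>R ?y + (1 - ?s) *\<^sub>R (k *\<^sub>R ?y + (1 - k) *\<^sub>R parallel_operator N T lam n ?y)
      = (?s + (1 - ?s) * k) *\<^sub>R ?y + ((1 - ?s) * (1 - k)) *\<^sub>R parallel_operator N T lam n ?y"
    by (simp only: scaleR_add_right scaleR_add_left scaleR_scaleR add.assoc)
  also have "\<dots> = t n *\<^sub>R ?y + (1 - t n) *\<^sub>R parallel_operator N T lam n ?y"
    by (simp only: 1 2)
  finally show ?case
    by (simp only: parallel_output.simps Suc.IH A)
qed simp

section \<open>Estimates for the modulus \<open>P_mod\<close>\<close>

lemma P_mod_pos:
  assumes "0 < a" "a \<le> 1" "0 < b" "0 < \<epsilon>"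
  shows "0 < P_mod a b \<epsilon>"
proof (cases "a = 1")
  case False
  then have "0 < a * \<epsilon>\<^sup>2 / (4 * (1 - a))"
    using assms by simp
  then have "b < sqrt (a * \<epsilon>\<^sup>2 / (4 * (1 - a)) + b\<^sup>2)"
    by (intro real_less_rsqrt) simp
  then show ?thesis
    using assms by (simp add: P_mod_def)
qed (use assms in \<open>simp add: P_mod_def\<close>)

lemma P_mod_le_half: "P_mod a b \<epsilon> \<le> \<epsilon> / 2"
  unfolding P_mod_def by (simp only: min.cobounded1 order_refl split: if_split) simp

text \<open>The square root solves \<open>P\<^sup>2 + 2 * b * P = c\<close> for \<open>P\<close>;
  dropping the square leaves the product that bounds a single displacement. With
  \<open>a \<le> 1 / 2\<close> the denominator of \<open>c\<close> is at least 1.\<close>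

lemma P_mod_bound:
  assumes "0 < a" "a \<le> 1 / 2" "0 < b" "0 < \<epsilon>"
  shows "2 * b * P_mod a b \<epsilon> \<le> a * \<epsilon>\<^sup>2"
proof -
  define c where "c = a * \<epsilon>\<^sup>2 / (4 * (1 - a))"
  have "P_mod a b \<epsilon> + b \<le> sqrt (c + b\<^sup>2)"
    using assms by (simp add: P_mod_def c_def)
  then have "(P_mod a b \<epsilon> + b)\<^sup>2 \<le> (sqrt (c + b\<^sup>2))\<^sup>2"
    using P_mod_pos[of a b \<epsilon>] assms by (intro power_mono) auto
  moreover have "c \<ge> 0"
    using assms by (simp add: c_def)
  ultimately have "(P_mod a b \<epsilon>)\<^sup>2 + 2 * b * P_mod a b \<epsilon> \<le> c"
    by (simp add: power2_eq_square algebra_simps)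
  then have "2 * b * P_mod a b \<epsilon> \<le> c"
    using zero_le_power2[of "P_mod a b \<epsilon>"] by linarith
  also have "c \<le> a * \<epsilon>\<^sup>2 / 1"
    unfolding c_def using assms by (intro divide_left_mono) auto
  finally show ?thesis by simp
qed

section \<open>The parallel algorithm for nonexpansive maps with a common fixed point\<close>

locale nonexpansive_parallel =
  fixes C :: "'a::real_inner set" and N :: nat and S :: "nat \<Rightarrow> 'a \<Rightarrow> 'a"
    and x p :: 'a and b :: real and s :: "nat \<Rightarrow> real" and lam :: "nat \<Rightarrow> nat \<Rightarrow> real"
  assumes convex_C: "convex C"
    and S_in: "\<And>i y. i \<in> {1..N} \<Longrightarrow> y \<in> C \<Longrightarrow> S i y \<in> C"
    and S_nonexpansive:
      "\<And>i y z. i \<in> {1..N} \<Longrightarrow> y \<in> C \<Longrightarrow> z \<in> C \<Longrightarrow> norm (S i y - S i z) \<le> norm (y - z)"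
    and x_in: "x \<in> C" and p_in: "p \<in> C"
    and S_fix: "\<And>i. i \<in> {1..N} \<Longrightarrow> S i p = p"
    and s_unit: "\<And>n. 0 \<le> s n" "\<And>n. s n \<le> 1"
    and lam_nonneg: "\<And>n i. i \<in> {1..N} \<Longrightarrow> 0 \<le> lam n i"
    and lam_sum: "\<And>n. (\<Sum>i=1..N. lam n i) = 1"
    and b_pos: "0 < b" and dist_le: "norm (x - p) \<le> b"
begin

abbreviation A where "A \<equiv> parallel_operator N S lam"

abbreviation X where "X \<equiv> parallel_output N S x s lam"

definition displacement :: "nat \<Rightarrow> real" where
  "displacement n = norm (X n - A n (X n))"

lemma displacement_nonneg: "0 \<le> displacement n"
  by (simp add: displacement_def)

lemma sum_lam_const: "(\<Sum>i=1..N. lam n i *\<^sub>R y) = y" for y :: 'a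
  by (simp only: scaleR_left.sum[symmetric] lam_sum scaleR_one)

lemma A_in: "y \<in> C \<Longrightarrow> A n y \<in> C"
  unfolding parallel_operator_def
  by (intro convex_sum convex_C lam_sum lam_nonneg S_in) auto

lemma A_fix: "A n p = p"
  using sum_lam_const[of n p] by (simp add: parallel_operator_def S_fix)

lemma A_nonexpansive:
  assumes "y \<in> C" "z \<in> C"
  shows "norm (A n y - A n z) \<le> norm (y - z)"
proof -
  have "A n y - A n z = (\<Sum>i=1..N. lam n i *\<^sub>R (S i y - S i z))"
    by (simp add: parallel_operator_def sum_subtractf scaleR_diff_right)
  also have "norm \<dots> \<le> (\<Sum>i=1..N. lam n i * norm (y - z))"
    using assms
    by (intro sum_norm_le) (auto simp: lam_nonneg intro!: mult_left_mono S_nonexpansive)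
  also have "\<dots> = norm (y - z)"
    by (simp only: sum_distrib_right[symmetric] lam_sum mult_1)
  finally show ?thesis .
qed

lemma X_in: "X n \<in> C"
proof (induction n)
  case (Suc n)
  then show ?case
    using convex_C A_in[OF Suc] s_unit[of n] by (auto intro!: convexD)
qed (simp add: x_in)

text \<open>The step is a convex combination of \<open>X n\<close> and \<open>A n (X n)\<close>, and
  the latter is no farther from \<open>p\<close>; the quadratic term of the convex combination
  identity is the gain.\<close>

lemma fejer:
  "(norm (X (Suc n) - p))\<^sup>2 + s n * (1 - s n) * (displacement n)\<^sup>2 \<le> (norm (X n - p))\<^sup>2"
proof -
  have "X (Suc n) - p = s n *\<^sub>R (X n - p) + (1 - s n) *\<^sub>R (A n (X n) - p)"
    by (simp add: algebra_simps)
  then have "(norm (X (Suc n) - p))\<^sup>2 = s n * (norm (X n - p))\<^sup>2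
      + (1 - s n) * (norm (A n (X n) - p))\<^sup>2 - s n * (1 - s n) * (displacement n)\<^sup>2"
    by (simp add: norm_convex_combination_square displacement_def del: parallel_output.simps)
  moreover have "norm (A n (X n) - p) \<le> norm (X n - p)"
    using A_nonexpansive[OF X_in p_in, of n n] by (simp add: A_fix)
  then have "(1 - s n) * (norm (A n (X n) - p))\<^sup>2 \<le> (1 - s n) * (norm (X n - p))\<^sup>2"
    using s_unit[of n] by (intro mult_left_mono power_mono) auto
  ultimately show ?thesis
    by (simp add: algebra_simps del: parallel_output.simps)
qed

text \<open>Telescopes \<open>fejer\<close>. Keeping the distance term on the left gives boundedness
  of the iterates and summability at once.\<close>

lemma sum_displacement:
  "(norm (X n - p))\<^sup>2 + (\<Sum>j<n. s j * (1 - s j) * (displacement j)\<^sup>2) \<le> b\<^sup>2"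
proof (induction n)
  case 0
  then show ?case
    using dist_le by (simp add: power_mono)
next
  case (Suc n)
  then show ?case
    using fejer[of n] by (simp del: parallel_output.simps)
qed

lemma sum_displacement_nonneg: "0 \<le> (\<Sum>j\<in>J. s j * (1 - s j) * (displacement j)\<^sup>2)"
  using s_unit by (intro sum_nonneg) simp

lemma X_dist_le: "norm (X n - p) \<le> b"
proof (rule power2_le_imp_le)
  show "(norm (X n - p))\<^sup>2 \<le> b\<^sup>2"
    using sum_displacement[of n] sum_displacement_nonneg[of "{..<n}"] by linarith
qed (use b_pos in simp)

lemma A_change:
  "norm (A m (X n) - A l (X n)) \<le> b * (\<Sum>i=1..N. \<bar>lam m i - lam l i\<bar>)"
proof -
  \<comment> \<open>Differences of weights sum to 0, so \<open>p\<close> may be subtracted from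
    every \<open>S i (X n)\<close>; the factor is then \<open>b\<close> instead of a bound on the
    norms of the images.\<close>
  have "(\<Sum>i=1..N. (lam m i - lam l i) *\<^sub>R p) = 0"
    by (simp only: scaleR_diff_left sum_subtractf sum_lam_const diff_self)
  then have "A m (X n) - A l (X n) = (\<Sum>i=1..N. (lam m i - lam l i) *\<^sub>R (S i (X n) - p))"
    by (simp add: parallel_operator_def scaleR_diff_right sum_subtractf scaleR_diff_left)
  also have "norm \<dots> \<le> (\<Sum>i=1..N. \<bar>lam m i - lam l i\<bar> * b)"
  proof (rule sum_norm_le)
    fix i assume i: "i \<in> {1..N}"
    have "norm (S i (X n) - p) \<le> b"
      using S_nonexpansive[OF i X_in p_in] S_fix[OF i] X_dist_le order_trans by metis
    then show "norm ((lam m i - lam l i) *\<^sub>R (S i (X n) - p)) \<le> \<bar>lam m i - lam l i\<bar> * b"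
      by (simp add: mult_left_mono)
  qed
  also have "\<dots> = b * (\<Sum>i=1..N. \<bar>lam m i - lam l i\<bar>)"
    by (simp add: sum_distrib_left mult.commute)
  finally show ?thesis .
qed

text \<open>With the operator frozen at \<open>A n\<close>, a step cannot increase the displacement;
  only the passage from \<open>A n\<close> to \<open>A (Suc n)\<close> costs something, as measured
  by \<open>A_change\<close>.\<close>

lemma displacement_Suc:
  "displacement (Suc n) \<le> displacement n + b * (\<Sum>i=1..N. \<bar>lam (Suc n) i - lam n i\<bar>)"
proof -
  let ?y = "X (Suc n)"
  have "?y - A n ?y = s n *\<^sub>R (X n - A n (X n)) + (A n (X n) - A n ?y)"
    by (simp add: algebra_simps)
  then have "norm (?y - A n ?y) \<le> norm (s n *\<^sub>R (X n - A n (X n))) + norm (A n (X n) - A n ?y)"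
    by (metis norm_triangle_ineq)
  also have "norm (A n (X n) - A n ?y) \<le> norm (X n - ?y)"
    by (intro A_nonexpansive X_in)
  also have "X n - ?y = (1 - s n) *\<^sub>R (X n - A n (X n))"
    by (simp add: algebra_simps)
  also have "norm (s n *\<^sub>R (X n - A n (X n))) + norm ((1 - s n) *\<^sub>R (X n - A n (X n))) = displacement n"
    using s_unit[of n] by (simp add: displacement_def distrib_right[symmetric])
  finally have "norm (?y - A n ?y) \<le> displacement n" by simp
  moreover have "displacement (Suc n) \<le> norm (?y - A n ?y) + norm (A (Suc n) ?y - A n ?y)"
    unfolding displacement_def by norm
  ultimately show ?thesis
    using A_change[of "Suc n" "Suc n" n] by linarith
qed

section \<open>Rate of convergence for the displacement of the averaged operators\<close>

lemma displacement_add: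
  "displacement (n + m) \<le> displacement n + b * (\<Sum>j=n..<n + m. \<Sum>i=1..N. \<bar>lam (j + 1) i - lam j i\<bar>)"
proof (induction m)
  case (Suc m)
  have "(\<Sum>j=n..<n + Suc m. \<Sum>i=1..N. \<bar>lam (j + 1) i - lam j i\<bar>)
      = (\<Sum>j=n..<n + m. \<Sum>i=1..N. \<bar>lam (j + 1) i - lam j i\<bar>)
        + (\<Sum>i=1..N. \<bar>lam (Suc (n + m)) i - lam (n + m) i\<bar>)"
    by simp
  then show ?case
    using Suc displacement_Suc[of "n + m"] by (simp only: distrib_left add_Suc_right)
qed simp

lemma displacement_rate:
  assumes \<epsilon>: "0 < \<epsilon>"
    and \<theta>: "\<And>K::nat. real K \<le> (\<Sum>n=0..\<theta> K. s n * (1 - s n))"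
    and \<gamma>: "\<And>\<epsilon> m. 0 < \<epsilon> \<Longrightarrow>
           (\<Sum>j=\<gamma> \<epsilon> + 1..\<gamma> \<epsilon> + m. \<Sum>i=1..N. \<bar>lam (j + 1) i - lam j i\<bar>) \<le> \<epsilon>"
    and n: "Phi b \<theta> \<gamma> \<epsilon> \<le> n"
  shows "displacement n \<le> \<epsilon>"
proof -
  define M where "M = \<gamma> (\<epsilon> / (6 * b))"
  define Q where "Q = nat \<lceil>4 * b\<^sup>2 / \<epsilon>\<^sup>2\<rceil>"
  define L where "L = \<theta> (M + Q + 1)"
  define w where "w j = s j * (1 - s j)" for j
  have w0: "0 \<le> w j" and w1: "w j \<le> 1" for j
    using s_unit[of j] by (auto simp: w_def mult_le_one)
  have n': "L \<le> n"
    using n by (simp add: Phi_def L_def M_def Q_def)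
  have Q: "4 * b\<^sup>2 / \<epsilon>\<^sup>2 \<le> real Q"
    unfolding Q_def by linarith
  \<comment> \<open>Beyond \<open>M\<close> the variation of the weights is controlled by
    \<open>\<gamma>\<close>, and up to \<open>L\<close> the index does not exceed
    \<open>n\<close>.\<close>
  have "\<exists>j\<in>{M<..L}. displacement j \<le> \<epsilon> / 2"
  proof (rule ccontr)
    assume "\<not> ?thesis"
    then have big: "\<epsilon> / 2 < displacement j" if "j \<in> {M<..L}" for j
      using that by (meson not_le)
    have "real (M + Q + 1) \<le> (\<Sum>j=0..L. w j)"
      using \<theta>[of "M + Q + 1"] by (simp add: L_def w_def)
    also have "\<dots> \<le> (\<Sum>j\<in>{..M} \<union> {M<..L}. w j)"
      by (intro sum_mono2) (auto simp: w0)
    also have "\<dots> = (\<Sum>j\<le>M. w j) + (\<Sum>j\<in>{M<..L}. w j)"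
      by (intro sum.union_disjoint) auto
    \<comment> \<open>The discarded indices \<open>0..M\<close> number \<open>M + 1\<close>, whence
      the summand 1 in the argument of \<open>\<theta>\<close>; mass at least \<open>Q\<close>
      remains in the window.\<close>
    also have "(\<Sum>j\<le>M. w j) \<le> real (M + 1)"
      using sum_bounded_above[of "{..M}" w 1] w1 by simp
    finally have Qw: "real Q \<le> (\<Sum>j\<in>{M<..L}. w j)" by simp
    have "b\<^sup>2 \<le> (\<epsilon> / 2)\<^sup>2 * real Q"
      using Q \<epsilon> by (simp add: field_simps power2_eq_square)
    also have "\<dots> \<le> (\<epsilon> / 2)\<^sup>2 * (\<Sum>j\<in>{M<..L}. w j)"
      using Qw by (intro mult_left_mono) auto
    also have "\<dots> = (\<Sum>j\<in>{M<..L}. w j * (\<epsilon> / 2)\<^sup>2)"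
      by (simp only: sum_distrib_right mult.commute)
    \<comment> \<open>The chain runs from \<open>b\<^sup>2\<close> back to \<open>b\<^sup>2\<close>,
      so one link must be strict. It is strict at an index of nonzero weight, which exists since the
      window has positive mass.\<close>
    also have "\<dots> < (\<Sum>j\<in>{M<..L}. w j * (displacement j)\<^sup>2)"
    proof (rule sum_strict_mono_ex1)
      show "\<forall>j\<in>{M<..L}. w j * (\<epsilon> / 2)\<^sup>2 \<le> w j * (displacement j)\<^sup>2"
        using big \<epsilon> w0 by (intro ballI mult_left_mono power_mono) (auto intro: less_imp_le)
      have "0 < 4 * b\<^sup>2 / \<epsilon>\<^sup>2"
        using b_pos \<epsilon> by simp
      then have "0 < (\<Sum>j\<in>{M<..L}. w j)"
        using Q Qw by linarith
      then obtain j where j: "j \<in> {M<..L}" "w j \<noteq> 0"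
        by (metis less_irrefl sum.neutral)
      moreover have "(\<epsilon> / 2)\<^sup>2 < (displacement j)\<^sup>2"
        using big[OF j(1)] \<epsilon> by (intro power_strict_mono) auto
      ultimately show "\<exists>j\<in>{M<..L}. w j * (\<epsilon> / 2)\<^sup>2 < w j * (displacement j)\<^sup>2"
        using w0[of j] by (intro bexI[of _ j] mult_strict_left_mono) auto
    qed simp
    also have "\<dots> \<le> (\<Sum>j<Suc L. w j * (displacement j)\<^sup>2)"
      by (intro sum_mono2) (auto simp: w0)
    also have "\<dots> \<le> b\<^sup>2"
      using sum_displacement[of "Suc L"] zero_le_power2[of "norm (X (Suc L) - p)"]
      unfolding w_def by linarith
    finally show False by simp
  qed
  then obtain j where j: "M < j" "j \<le> L" "displacement j \<le> \<epsilon> / 2"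
    by auto
  let ?v = "\<lambda>j. \<Sum>i=1..N. \<bar>lam (j + 1) i - lam j i\<bar>"
  have "displacement n \<le> displacement j + b * (\<Sum>l=j..<n. ?v l)"
    using displacement_add[of j "n - j"] j n' by simp
  \<comment> \<open>Enlarges the range to the form governed by \<open>\<gamma>\<close>, with length
    \<open>m = n\<close>.\<close>
  also have "(\<Sum>l=j..<n. ?v l) \<le> (\<Sum>l=M + 1..M + n. ?v l)"
    using j by (intro sum_mono2) (auto intro!: sum_nonneg)
  also have "\<dots> \<le> \<epsilon> / (6 * b)"
    unfolding M_def using \<epsilon> b_pos by (intro \<gamma>) simp
  finally have "displacement n \<le> \<epsilon> / 2 + \<epsilon> / 6"
    using j(3) b_pos by (simp add: field_simps)
  then show ?thesis using \<epsilon> by simp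
qed

section \<open>From the averaged operator to the single maps\<close>

lemma single_displacement:
  assumes i: "i \<in> {1..N}" and y: "y \<in> C" and a: "0 \<le> a" "a \<le> lam n i"
  shows "a * (norm (y - S i y))\<^sup>2 \<le> 2 * norm (y - A n y) * norm (y - p)"
proof -
  have S: "(norm (y - S j y))\<^sup>2 \<le> 2 * ((y - S j y) \<bullet> (y - p))" if j: "j \<in> {1..N}" for j
  proof -
    \<comment> \<open>Writing \<open>S j y - p\<close> as \<open>(y - p) - (y - S j y)\<close> and
      expanding the square gives the claim.\<close>
    have "(norm (S j y - p))\<^sup>2 \<le> (norm (y - p))\<^sup>2"
      using S_nonexpansive[OF j y p_in] S_fix[OF j] by (simp add: power_mono)
    then show ?thesis
      unfolding power2_norm_eq_inner by (simp add: inner_simps inner_commute)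
  qed
  have "y - A n y = (\<Sum>j=1..N. lam n j *\<^sub>R (y - S j y))"
    by (simp only: scaleR_diff_right sum_subtractf sum_lam_const parallel_operator_def)
  then have A: "(y - A n y) \<bullet> (y - p) = (\<Sum>j=1..N. lam n j * ((y - S j y) \<bullet> (y - p)))"
    by (simp add: inner_sum_left)
  have "a * (norm (y - S i y))\<^sup>2 \<le> lam n i * (norm (y - S i y))\<^sup>2"
    using a by (intro mult_right_mono) auto
  \<comment> \<open>All terms are nonnegative, so the term of \<open>i\<close> is dominated by the
    whole average.\<close>
  also have "\<dots> \<le> (\<Sum>j=1..N. lam n j * (norm (y - S j y))\<^sup>2)"
    using i by (intro member_le_sum) (auto simp: lam_nonneg)
  also have "\<dots> \<le> (\<Sum>j=1..N. lam n j * (2 * ((y - S j y) \<bullet> (y - p))))"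
    by (intro sum_mono mult_left_mono S lam_nonneg)
  also have "\<dots> = 2 * ((y - A n y) \<bullet> (y - p))"
    by (simp only: A sum_distrib_left mult.left_commute)
  also have "\<dots> \<le> 2 * (norm (y - A n y) * norm (y - p))"
    using norm_cauchy_schwarz by (intro mult_left_mono) auto
  finally show ?thesis by simp
qed

lemma single_displacement_rate:
  assumes a: "0 < a" "\<And>n i. i \<in> {1..N} \<Longrightarrow> a \<le> lam n i"
    and \<epsilon>: "0 < \<epsilon>"
    and \<theta>: "\<And>K::nat. real K \<le> (\<Sum>n=0..\<theta> K. s n * (1 - s n))"
    and \<gamma>: "\<And>\<epsilon> m. 0 < \<epsilon> \<Longrightarrow>
           (\<Sum>j=\<gamma> \<epsilon> + 1..\<gamma> \<epsilon> + m. \<Sum>i=1..N. \<bar>lam (j + 1) i - lam j i\<bar>) \<le> \<epsilon>"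
    and n: "Phi' a b \<theta> \<gamma> \<epsilon> \<le> n" and i: "i \<in> {1..N}"
  shows "norm (X n - S i (X n)) \<le> \<epsilon>"
proof -
  have Na: "real N * a \<le> 1"
    using sum_bounded_below[of "{1..N}" a "lam n"] a(2) lam_sum[of n] by simp
  have "1 * a \<le> real N * a"
    using i a(1) by (intro mult_right_mono) auto
  then have "a \<le> 1"
    using Na by simp
  then have P: "0 < P_mod a b \<epsilon>"
    using P_mod_pos a(1) b_pos \<epsilon> by blast
  have d: "displacement n \<le> P_mod a b \<epsilon>"
    using displacement_rate[OF P \<theta> \<gamma>] n by (simp add: Phi'_def)
  \<comment> \<open>At least two operators force \<open>a \<le> 1 / 2\<close>, and then the square root in \<open>P_mod\<close> is small enough;
    for a single operator the entry \<open>\<epsilon> / 2\<close> suffices.\<close>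
  show ?thesis
  proof (cases "N = 1")
    case True
    then have "A n (X n) = S i (X n)"
      using i lam_sum[of n] by (simp add: parallel_operator_def)
    then show ?thesis
      using d P_mod_le_half[of a b \<epsilon>] \<epsilon> by (simp add: displacement_def)
  next
    case False
    then have "2 * a \<le> real N * a"
      using i a(1) by (intro mult_right_mono) auto
    then have a2: "a \<le> 1 / 2"
      using Na by simp
    have "a * (norm (X n - S i (X n)))\<^sup>2 \<le> 2 * displacement n * norm (X n - p)"
      unfolding displacement_def using i X_in a by (intro single_displacement) auto
    also have "\<dots> \<le> 2 * P_mod a b \<epsilon> * b"
      using d X_dist_le[of n] displacement_nonneg P by (intro mult_mono) auto
    also have "\<dots> \<le> a * \<epsilon>\<^sup>2"
      using P_mod_bound[OF a(1) a2 b_pos \<epsilon>] by (simp add: mult_ac)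
    finally have "(norm (X n - S i (X n)))\<^sup>2 \<le> \<epsilon>\<^sup>2"
      using a(1) by simp
    then show ?thesis
      using \<epsilon> by (rule power2_le_imp_le[OF _ less_imp_le])
  qed
qed

end

section \<open>Transfer to strict pseudocontractions by relaxation\<close>

theorem theorem3p10:
  fixes C :: "'a::{real_inner, complete_space} set"
    and N :: nat
    and T :: "nat \<Rightarrow> 'a \<Rightarrow> 'a"
    and ks :: "nat \<Rightarrow> real"
    and k a b :: real
    and x p :: 'a
    and t :: "nat \<Rightarrow> real"
    and lam :: "nat \<Rightarrow> nat \<Rightarrow> real"
    and \<theta> :: "nat \<Rightarrow> nat"
    and \<gamma> :: "real \<Rightarrow> nat"
  assumes "closed C" and "convex C"
    and "N \<ge> 1"
    and "\<And>i. i \<in> {1..N} \<Longrightarrow> ks i \<in> {0..<1}"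
    and "\<And>i. i \<in> {1..N} \<Longrightarrow> T i ` C \<subseteq> C"
    and "\<And>i. i \<in> {1..N} \<Longrightarrow> strict_pseudocontraction_on (ks i) C (T i)"
    and "k = Max (ks ` {1..N})"
    and "x \<in> C"
    and "\<And>n. t n \<in> {k..1}"
    and "\<And>n i. i \<in> {1..N} \<Longrightarrow> lam n i > 0"
    and "\<And>n. (\<Sum>i=1..N. lam n i) = 1"
    and "b > 0" and "p \<in> (\<Inter>i\<in>{1..N}. Fix_on C (T i))"
    and "norm x \<le> b" and "norm (x - p) \<le> b"
    and "a > 0" and "a \<le> (INF (i, n) \<in> {1..N} \<times> UNIV. lam n i)"
    and "\<And>K::nat. (\<Sum>n=0..\<theta> K. (t n - k) * (1 - t n)) \<ge> real K"
    and "\<And>\<epsilon> m. \<epsilon> > 0 \<Longrightarrow>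
           (\<Sum>j=\<gamma> \<epsilon> + 1..\<gamma> \<epsilon> + m. \<Sum>i=1..N. \<bar>lam (j + 1) i - lam j i\<bar>) \<le> \<epsilon>"
  shows "\<forall>\<epsilon>>0. \<forall>n \<ge> Phi'' a b k \<theta> \<gamma> \<epsilon>. \<forall>i\<in>{1..N}.
           norm (parallel_output N T x t lam n - T i (parallel_output N T x t lam n)) \<le> \<epsilon>"
proof (intro allI impI ballI)
  fix \<epsilon> :: real and n i
  assume \<epsilon>: "0 < \<epsilon>" and n: "Phi'' a b k \<theta> \<gamma> \<epsilon> \<le> n" and i: "i \<in> {1..N}"
  note ks = assms(4) and T_in = assms(5) and T_spc = assms(6) and t = assms(9)
    and lam_pos = assms(10) and lam_sum = assms(11) and \<theta> = assms(18) and \<gamma> = assms(19)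
  have p: "p \<in> C" "\<And>i. i \<in> {1..N} \<Longrightarrow> T i p = p"
    using assms(13) i by (auto simp: Fix_on_def)
  have ks_le: "ks i \<le> k" if "i \<in> {1..N}" for i
    using that by (simp add: assms(7))
  have k0: "0 \<le> k"
    using ks[OF i] ks_le[OF i] by simp
  have k1: "k < 1"
    using ks i unfolding assms(7) by (subst Max_less_iff) auto
  have lam_ge: "a \<le> lam n i" if "i \<in> {1..N}" for n i
  proof -
    \<comment> \<open>A real infimum is a lower bound only for a set bounded below; positivity of
      the weights supplies the bound 0.\<close>
    have "bdd_below ((\<lambda>(i, n). lam n i) ` ({1..N} \<times> UNIV))"
      by (rule bdd_belowI[of _ 0]) (auto simp: less_imp_le[OF lam_pos])
    then have "(INF (i, n) \<in> {1..N} \<times> UNIV. lam n i) \<le> (case (i, n) of (i, n) \<Rightarrow> lam n i)"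
      using that by (intro cINF_lower) auto
    then show ?thesis
      using assms(17) by simp
  qed
  define S where "S = (\<lambda>i y. k *\<^sub>R y + (1 - k) *\<^sub>R T i y)"
  define s where "s = (\<lambda>n. (t n - k) / (1 - k))"
  have X: "parallel_output N S x s lam m = parallel_output N T x t lam m" for m
    unfolding S_def s_def using k1 lam_sum by (intro parallel_output_relaxation) auto
  interpret nonexpansive_parallel C N S x p b s lam
  proof
    fix i y assume i: "i \<in> {1..N}" and y: "y \<in> C"
    show "S i y \<in> C"
      unfolding S_def using T_in[OF i] y k0 k1 by (intro convexD[OF assms(2)]) auto
    fix z assume z: "z \<in> C"
    show "norm (S i y - S i z) \<le> norm (y - z)"
      unfolding S_def
      using strict_pseudocontraction_on_mono[OF T_spc[OF i] ks_le[OF i]] k1 y z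
      by (intro strict_pseudocontraction_relaxation_nonexpansive) auto
  next
    show "S i p = p" if "i \<in> {1..N}" for i
      using p(2)[OF that] by (simp add: S_def algebra_simps)
    show "0 \<le> s n" "s n \<le> 1" for n
      using t[of n] k1 by (auto simp: s_def)
    show "0 \<le> lam n i" if "i \<in> {1..N}" for n i
      using lam_pos[OF that] by (rule less_imp_le)
  qed (use assms p in auto)
  have s_sum: "real K \<le> (\<Sum>n=0..\<theta> K. s n * (1 - s n))" for K
  proof -
    \<comment> \<open>Rescaling divides the product by \<open>(1 - k)\<^sup>2 \<le> 1\<close>, so
      \<open>\<theta>\<close> remains a divergence rate for \<open>s\<close>.\<close>
    have "(t n - k) * (1 - t n) \<le> s n * (1 - s n)" for n
    proof -
      have "(t n - k) * (1 - t n) = (1 - k)\<^sup>2 * (s n * (1 - s n))"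
        using k1 by (simp add: s_def divide_simps power2_eq_square)
      also have "\<dots> \<le> 1 * (s n * (1 - s n))"
        using k0 k1 s_unit[of n] by (intro mult_right_mono) (auto simp: power_le_one)
      finally show ?thesis by simp
    qed
    then show ?thesis
      using \<theta>[of K] by (meson order_trans sum_mono)
  qed
  have "norm (X n - S i (X n)) \<le> (1 - k) * \<epsilon>"
    using \<epsilon> k1 n i assms(16) lam_ge s_sum \<gamma>
    by (intro single_displacement_rate[of a _ \<theta> \<gamma>]) (auto simp: Phi''_def)
  \<comment> \<open>Relaxation shrinks displacements by \<open>1 - k\<close>, hence the rate was
    taken at \<open>(1 - k) * \<epsilon>\<close>.\<close>
  moreover have "X n - S i (X n) = (1 - k) *\<^sub>R (X n - T i (X n))"
    by (simp add: S_def algebra_simps)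
  ultimately show "norm (parallel_output N T x t lam n - T i (parallel_output N T x t lam n)) \<le> \<epsilon>"
    using k1 by (simp add: X)
qed

end
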